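(* Let $p\ge2$, $\nu>0$, $\Delta t>0$, $\boldsymbol\rho_{f,h}^{k+1}\in[\mathbb{V}_h^{x,p}]^3$, $g_h^\star\in\mathbb{V}_h^p$, and suppose $g_h^{k+1}\in\mathbb{V}_h^p$ satisfies $$(g_h^{k+1},\varphi_h)_{ij}=(g_h^\star,\varphi_h)_{ij}-\Delta t\,\nu\,B_h^{\mathrm{LB}}(g_h^{k+1},\boldsymbol\rho_{f,h}^{k+1},\varphi_h)_{ij}$$ for all $\varphi_h\in\mathbb{V}_h^p$ and all $i=1,\dots,N^x$, $j=1,\dots,N^v$, where the spatial integrals in $B_h^{\mathrm{LB}}$ are evaluated with the $(p+1)$-point Gauss--Legendre quadrature on each $I_i^x$. Assume that $(\boldsymbol\rho_{g_h}^\star)_q^i=0$ for all $i$ and all $x_q\in S_i^x$ (so that $(\langle\mathbf e g_h^\star\rangle_{D^v},\psi_h)_i=0$ for all $\psi_h\in\mathbb{V}_h^{x,p}$). Then $(\boldsymbol\rho_{g_h}^{k+1})_q^i=0$ for all $i$ and all $x_q\in S_i^x$.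
   Context: Notation. $\mathbf e=(1,v,\tfrac12v^2)^{\mathrm T}$, and $\langle\cdot\rangle_\Omega=\int_\Omega\cdot\,dv$. Vector-valued expressions are componentwise. Mesh. $D^x=[x_{\min},x_{\max}]$ and $D^v=[v_{\min},v_{\max}]$ are bounded intervals, partitioned by $x_{\min}=x_{1/2}<\dots<x_{N^x+1/2}=x_{\max}$ and $v_{\min}=v_{1/2}<\dots<v_{N^v+1/2}=v_{\max}$ into elements $I_i^x=(x_{i-1/2},x_{i+1/2})$, $I_j^v=(v_{j-1/2},v_{j+1/2})$, with $I_{ij}=I_i^x\times I_j^v$. $\mathbb{V}_h^p$: functions that on each $I_{ij}$ are polynomials of degree at most $p$ in each of $x$ and $v$; $\mathbb{V}_h^{x,p}$: functions that on each $I_i^x$ are polynomials of degree at most $p$ (no continuity across elements). $(a,b)_{ij}=\int_{I_{ij}}ab\,dx\,dv$, $(a,b)_i=\int_{I_i^x}ab\,dx$. Superscripts $\pm$ on arguments denote one-sided limits from above/below. Nodes. $S_i^x=\{x_1,\dots,x_{p+1}\}\subset I_i^x$ are the $(p+1)$-point Gauss--Legendre nodes. For $g_h\in\mathbb{V}_h^p$, $(\boldsymbol\rho_{g_h})_q^i=\sum_{j=1}^{N^v}\int_{I_j^v}\mathbf e(v)g_h(x_q,v)\,dv$. Moments. $n_{f,h},u_{f,h},\theta_{f,h}$ are obtained from $\boldsymbol\rho_{f,h}=(\rho_0,\rho_1,\rho_2)^{\mathrm T}$ pointwise by $\boldsymbol\rho_{f,h}=(n,\,nu,\,\tfrac12n(u^2+\theta))^{\mathrm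 T}$, i.e. $n=\rho_0$, $u=\rho_1/\rho_0$, $\theta=2\rho_2/\rho_0-u^2$ (with $\rho_0\ne0$ at the nodes), and $w(x,v)=u_{f,h}(x)-v$. Lenard--Bernstein form: $$\begin{aligned}B_h^{\mathrm{LB}}(g_h,\boldsymbol\rho_{f,h},\varphi_h)_{ij}={}&\int_{I_i^x}\big[\widehat{wg_h}(x,v_{j+1/2})\varphi_h(x,v_{j+1/2}^-)-\widehat{wg_h}(x,v_{j-1/2})\varphi_h(x,v_{j-1/2}^+)\big]dx-(wg_h,\partial_v\varphi_h)_{ij}\\&-\int_{I_i^x}\theta_{f,h}\Big\{\big[\partial_v\mathfrak g_h(x,v_{j+1/2})\varphi_h(x,v_{j+1/2}^-)-\mathfrak g_h(x,v_{j+1/2})\partial_v\varphi_h(x,v_{j+1/2}^-)\big]\\&\qquad-\big[\partial_v\mathfrak g_h(x,v_{j-1/2})\varphi_h(x,v_{j-1/2}^+)-\mathfrak g_h(x,v_{j-1/2})\partial_v\varphi_h(x,v_{j-1/2}^+)\big]\Big\}dx-(\theta_{f,h}g_h,\partial_{vv}\varphi_h)_{ij}.\end{aligned}$$ Here at interior velocity interfaces $\widehat{wg_h}(x,v)=\frac{w+|w|}2g_h(x,v^-)+\frac{w-|w|}2g_h(x,v^+)$, and $\mathfrak g_h$ near $v_{j+1/2}$ is the recovery polynomial: the unique polynomial on $I_i^x\times(v_{j-1/2},v_{j+3/2})$ of degree at most $p$ in $x$ and at most $2p+1$ in $v$ with $(\mathfrak g_h,\varphi_h)_{ij}=(g_h,\varphi_h)_{ij}$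 and $(\mathfrak g_h,\varphi_h)_{i,j+1}=(g_h,\varphi_h)_{i,j+1}$ for all $\varphi_h\in\mathbb{V}_h^p$. At the velocity boundaries one imposes $\widehat{wg_h}-\theta_{f,h}\partial_v\mathfrak g_h=0$ and $\mathfrak g_h=0$ at $v=v_{\min}$ and at $v=v_{\max}$. Velocity integrals, and the inner products $(g_h^{k+1},\varphi_h)_{ij}$, $(g_h^\star,\varphi_h)_{ij}$, are exact. *)

theory Defs
  imports "HOL-Analysis.Analysis" "HOL-Computational_Algebra.Polynomial"
begin

text \<open>
  A partition of \<open>[a, b]\<close> into \<open>N\<close> elements. Interfaces are indexed by \<open>0, \<dots>, N\<close>, so that
  \<open>z k\<close> is the point with half-integer index \<open>k + 1/2\<close>; elements are indexed by \<open>1, \<dots>, N\<close>.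
\<close>

definition mesh :: "nat \<Rightarrow> real \<Rightarrow> real \<Rightarrow> (nat \<Rightarrow> real) \<Rightarrow> bool" where
  "mesh N a b z \<longleftrightarrow> 1 \<le> N \<and> z 0 = a \<and> z N = b \<and> (\<forall>k<N. z k < z (Suc k))"

definition elem :: "(nat \<Rightarrow> real) \<Rightarrow> nat \<Rightarrow> real set" where
  "elem z i = {z (i - 1)<..<z i}"

definition bipoly_on :: "nat \<Rightarrow> nat \<Rightarrow> real set \<Rightarrow> real set \<Rightarrow> (real \<Rightarrow> real \<Rightarrow> real) \<Rightarrow> bool" where
  "bipoly_on m n X V g \<longleftrightarrow>
     (\<exists>c::nat \<Rightarrow> nat \<Rightarrow> real. \<forall>x\<in>X. \<forall>v\<in>V. g x v = (\<Sum>a\<le>m. \<Sum>b\<le>n. c a b * x ^ a * v ^ b))"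

text \<open>
  Elements are open, so members of the broken polynomial spaces are unconstrained on the
  mesh interfaces; interface values enter only through one-sided limits.
\<close>

definition DG_x :: "nat \<Rightarrow> nat \<Rightarrow> (nat \<Rightarrow> real) \<Rightarrow> (real \<Rightarrow> real) set" where
  "DG_x p Nx xs = {r. \<forall>i\<in>{1..Nx}. \<exists>q::real poly. degree q \<le> p \<and> (\<forall>x\<in>elem xs i. r x = poly q x)}"

definition DG_xv ::
  "nat \<Rightarrow> nat \<Rightarrow> nat \<Rightarrow> (nat \<Rightarrow> real) \<Rightarrow> (nat \<Rightarrow> real) \<Rightarrow> (real \<Rightarrow> real \<Rightarrow> real) set" where
  "DG_xv p Nx Nv xs vs =
     {g. \<forall>i\<in>{1..Nx}. \<forall>j\<in>{1..Nv}. bipoly_on p p (elem xs i) (elem vs j) g}"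

definition inner_elem ::
  "(nat \<Rightarrow> real) \<Rightarrow> (nat \<Rightarrow> real) \<Rightarrow> nat \<Rightarrow> nat \<Rightarrow>
   (real \<Rightarrow> real \<Rightarrow> real) \<Rightarrow> (real \<Rightarrow> real \<Rightarrow> real) \<Rightarrow> real" where
  "inner_elem xs vs i j a b = integral (elem xs i \<times> elem vs j) (\<lambda>(x, v). a x v * b x v)"

definition left_lim :: "(real \<Rightarrow> real) \<Rightarrow> real \<Rightarrow> real" where
  "left_lim f a = Lim (at_left a) f"

definition right_lim :: "(real \<Rightarrow> real) \<Rightarrow> real \<Rightarrow> real" where
  "right_lim f a = Lim (at_right a) f"

text \<open>Legendre polynomials by Rodrigues' formula.\<close>

definition legendre_poly :: "nat \<Rightarrow> real poly" where
  "legendre_poly n = smult (1 / (2 ^ n * fact n)) ((pderiv ^^ n) ([:-1, 0, 1:] ^ n))"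

text \<open>
  The \<open>(p+1)\<close>-point Gauss-Legendre rule on element \<open>i\<close>: the nodes are the roots of the Legendre
  polynomial of degree \<open>p + 1\<close>, mapped affinely from \<open>(-1, 1)\<close>; the weights are the integrals
  of the Lagrange basis polynomials of these nodes.
\<close>

definition GL_nodes :: "nat \<Rightarrow> (nat \<Rightarrow> real) \<Rightarrow> nat \<Rightarrow> real set" where
  "GL_nodes p xs i =
     (\<lambda>t. (xs (i - 1) + xs i) / 2 + (xs i - xs (i - 1)) / 2 * t) `
       {t. poly (legendre_poly (Suc p)) t = 0}"

definition GL_weight :: "nat \<Rightarrow> (nat \<Rightarrow> real) \<Rightarrow> nat \<Rightarrow> real \<Rightarrow> real" where
  "GL_weight p xs i x =
     integral (elem xs i) (\<lambda>y. \<Prod>s\<in>GL_nodes p xs i - {x}. (y - s) / (x - s))"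

definition GL_quad :: "nat \<Rightarrow> (nat \<Rightarrow> real) \<Rightarrow> nat \<Rightarrow> (real \<Rightarrow> real) \<Rightarrow> real" where
  "GL_quad p xs i F = (\<Sum>x\<in>GL_nodes p xs i. GL_weight p xs i x * F x)"

definition evec :: "real \<Rightarrow> real ^ 3" where
  "evec v = vector [1, v, v\<^sup>2 / 2]"

definition moments ::
  "nat \<Rightarrow> (nat \<Rightarrow> real) \<Rightarrow> (real \<Rightarrow> real \<Rightarrow> real) \<Rightarrow> real \<Rightarrow> real ^ 3" where
  "moments Nv vs g x = (\<Sum>j=1..Nv. integral (elem vs j) (\<lambda>v. g x v *\<^sub>R evec v))"

text \<open>
  Bulk velocity and temperature of the moment vector \<open>(n, n u, n (u\<^sup>2 + \<theta>) / 2)\<close>, whose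
  components are indexed by \<open>1, 2, 3\<close>.
\<close>

definition bulk_u :: "(real \<Rightarrow> real ^ 3) \<Rightarrow> real \<Rightarrow> real" where
  "bulk_u rho x = rho x $ 2 / rho x $ 1"

definition temp :: "(real \<Rightarrow> real ^ 3) \<Rightarrow> real \<Rightarrow> real" where
  "temp rho x = 2 * (rho x $ 3) / rho x $ 1 - (bulk_u rho x)\<^sup>2"

definition drift :: "(real \<Rightarrow> real ^ 3) \<Rightarrow> real \<Rightarrow> real \<Rightarrow> real" where
  "drift rho x v = bulk_u rho x - v"

text \<open>
  \<open>R\<close> is the recovery polynomial of \<open>g\<close> in column \<open>i\<close> at the interior interface \<open>k\<close>, which
  separates the velocity elements \<open>k\<close> and \<open>k + 1\<close>. The conditions determine \<open>R\<close> uniquely on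
  the patch formed by these two elements; nothing is said about \<open>R\<close> elsewhere.
\<close>

definition is_recovery ::
  "nat \<Rightarrow> nat \<Rightarrow> nat \<Rightarrow> (nat \<Rightarrow> real) \<Rightarrow> (nat \<Rightarrow> real) \<Rightarrow> (real \<Rightarrow> real \<Rightarrow> real) \<Rightarrow>
   nat \<Rightarrow> nat \<Rightarrow> (real \<Rightarrow> real \<Rightarrow> real) \<Rightarrow> bool" where
  "is_recovery p Nx Nv xs vs g i k R \<longleftrightarrow>
     bipoly_on p (2 * p + 1) (elem xs i) {vs (k - 1)<..<vs (k + 1)} R \<and>
     (\<forall>\<phi>\<in>DG_xv p Nx Nv xs vs.
        inner_elem xs vs i k R \<phi> = inner_elem xs vs i k g \<phi> \<and>
        inner_elem xs vs i (k + 1) R \<phi> = inner_elem xs vs i (k + 1) g \<phi>)"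

definition upwind_flux ::
  "(nat \<Rightarrow> real) \<Rightarrow> (real \<Rightarrow> real ^ 3) \<Rightarrow> (real \<Rightarrow> real \<Rightarrow> real) \<Rightarrow> nat \<Rightarrow> real \<Rightarrow> real" where
  "upwind_flux vs rho g k x =
     (let w = drift rho x (vs k) in
        (w + \<bar>w\<bar>) / 2 * left_lim (g x) (vs k) + (w - \<bar>w\<bar>) / 2 * right_lim (g x) (vs k))"

text \<open>
  Interface data of \<open>g\<close>: \<open>F k x\<close> is the numerical drift flux at velocity interface \<open>k\<close>, and
  \<open>G i k\<close> is the function whose value and \<open>v\<close>-derivative at interface \<open>k\<close> enter the diffusion
  terms of column \<open>i\<close>. In the interior they are the upwind flux and the recovery polynomial; at
  \<open>k = 0\<close> and \<open>k = Nv\<close> they are constrained only by the two boundary conditions.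
\<close>

definition LB_interface_data ::
  "nat \<Rightarrow> nat \<Rightarrow> nat \<Rightarrow> (nat \<Rightarrow> real) \<Rightarrow> (nat \<Rightarrow> real) \<Rightarrow> (real \<Rightarrow> real \<Rightarrow> real) \<Rightarrow>
   (real \<Rightarrow> real ^ 3) \<Rightarrow> (nat \<Rightarrow> real \<Rightarrow> real) \<Rightarrow> (nat \<Rightarrow> nat \<Rightarrow> real \<Rightarrow> real \<Rightarrow> real) \<Rightarrow> bool" where
  "LB_interface_data p Nx Nv xs vs g rho F G \<longleftrightarrow>
     (\<forall>i\<in>{1..Nx}.
        (\<forall>k\<in>{1..<Nv}.
           is_recovery p Nx Nv xs vs g i k (G i k) \<and>
           (\<forall>x\<in>elem xs i. F k x = upwind_flux vs rho g k x)) \<and>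
        (\<forall>k\<in>{0, Nv}. \<forall>x\<in>elem xs i.
           F k x - temp rho x * deriv (G i k x) (vs k) = 0 \<and>
           G i k x (vs k) = 0))"

text \<open>
  The Lenard-Bernstein form on element \<open>(i, j)\<close>. The argument \<open>Q\<close> is the rule by which
  integrals over the spatial elements are evaluated; velocity integrals are exact.
\<close>

definition LB_form ::
  "(nat \<Rightarrow> (real \<Rightarrow> real) \<Rightarrow> real) \<Rightarrow> (nat \<Rightarrow> real) \<Rightarrow> (real \<Rightarrow> real \<Rightarrow> real) \<Rightarrow>
   (real \<Rightarrow> real ^ 3) \<Rightarrow> (nat \<Rightarrow> real \<Rightarrow> real) \<Rightarrow> (nat \<Rightarrow> nat \<Rightarrow> real \<Rightarrow> real \<Rightarrow> real) \<Rightarrow>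
   (real \<Rightarrow> real \<Rightarrow> real) \<Rightarrow> nat \<Rightarrow> nat \<Rightarrow> real" where
  "LB_form Q vs g rho F G \<phi> i j =
     Q i (\<lambda>x. F j x * left_lim (\<phi> x) (vs j) - F (j - 1) x * right_lim (\<phi> x) (vs (j - 1)))
     - Q i (\<lambda>x. integral (elem vs j) (\<lambda>v. drift rho x v * g x v * deriv (\<phi> x) v))
     - Q i (\<lambda>x. temp rho x *
          ((deriv (G i j x) (vs j) * left_lim (\<phi> x) (vs j)
             - G i j x (vs j) * left_lim (deriv (\<phi> x)) (vs j))
           - (deriv (G i (j - 1) x) (vs (j - 1)) * right_lim (\<phi> x) (vs (j - 1))
             - G i (j - 1) x (vs (j - 1)) * right_lim (deriv (\<phi> x)) (vs (j - 1)))))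
     - Q i (\<lambda>x. integral (elem vs j) (\<lambda>v. temp rho x * g x v * deriv (deriv (\<phi> x)) v))"

end

theory Submission
  imports Defs
begin

text \<open>
  Test the scheme in column \<open>i\<close> with \<open>\<phi>(x, v) = \<psi>(x) e(v)\<close>, where \<open>e\<close> is \<open>1\<close>, \<open>v\<close> or \<open>v\<^sup>2 / 2\<close>, and
  add over the velocity elements. Such a \<open>\<phi>\<close> is smooth across the velocity interfaces, and the
  interface data are single-valued there, so what the form collects at each interior interface
  enters the two neighbouring elements with opposite signs and cancels. The two
  outer interfaces contribute nothing because of the boundary conditions. With \<open>V e\<close> for the
  velocity moment of \<open>g\<close> against \<open>e\<close>, only the volume terms survive
  (\<open>sum_LB_form_separable\<close>), namely minus the quadrature of \<open>\<psi> (V ((u - v) e') + \<theta> V e'')\<close>.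

  The three choices of \<open>e\<close> close up one after the other. For \<open>e = 1\<close> the bracket is zero.
  For \<open>e = v\<close> it is \<open>u V 1 - V v\<close>, which equals \<open>- V v\<close> once the mass \<open>V 1\<close> vanishes at the nodes.
  For \<open>e = v\<^sup>2 / 2\<close> it is \<open>u V v - 2 V (v\<^sup>2 / 2) + \<theta> V 1\<close>, which equals \<open>- 2 V (v\<^sup>2 / 2)\<close> once mass and
  momentum vanish there. So in each case \<open>\<integral> \<psi> V e = \<integral> \<psi> V\<^sup>* e - c Q(\<psi> V e)\<close> with a constant
  \<open>c \<ge> 0\<close>, where \<open>Q\<close> is the quadrature and \<open>V\<^sup>* e\<close> the moment of the given data.

  Both moments are polynomials of degree at most \<open>p\<close> in \<open>x\<close> on the element. The second one has the
  \<open>p + 1\<close> nodes as zeros, so it vanishes identically. Taking \<open>V e\<close> itself for \<open>\<psi>\<close>, and using that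
  \<open>Q\<close> is exact up to degree \<open>2 p + 1\<close>, leaves \<open>(1 + c) \<integral> (V e)\<^sup>2 = 0\<close>, hence \<open>V e = 0\<close>
  (\<open>vanishing_moment\<close>).

  Besides the exactness of Gauss-Legendre quadrature (\<open>GL_quad_exact\<close>) this needs that there are
  \<open>p + 1\<close> nodes and that they lie in the open element (\<open>GL_nodes_facts\<close>): the boundary conditions
  and the polynomial form of \<open>g\<close> are available only there.
\<close>

section \<open>Gauss-Legendre quadrature\<close>

lemma poly_integrable: "poly f integrable_on {a<..<b}" for a b :: real
  by (intro integrable_on_open_interval_real[THEN iffD2] integrable_continuous_real continuous_intros)

lemma integral_pderiv:
  fixes a b :: real
  assumes "a \<le> b"
  shows "integral {a<..<b} (poly (pderiv f)) = poly f b - poly f a"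
proof -
  have "(poly (pderiv f) has_integral (poly f b - poly f a)) {a..b}"
    using assms by (intro fundamental_theorem_of_calculus)
      (auto intro!: has_field_derivative_at_within[OF poly_DERIV]
        simp flip: has_real_derivative_iff_has_vector_derivative)
  then show ?thesis
    by (metis integral_open_interval_real integral_unique)
qed

lemma dvd_pderiv_lower_power:
  fixes f :: "real poly"
  assumes "[:-c, 1:] ^ Suc k dvd f"
  shows "[:-c, 1:] ^ k dvd pderiv f"
proof -
  obtain h where "f = [:-c, 1:] ^ Suc k * h" using assms by (elim dvdE)
  then have "pderiv f = [:-c, 1:] ^ k * ([:-c, 1:] * pderiv h + smult (of_nat (Suc k)) h)"
    by (simp only: pderiv_mult pderiv_power_Suc) (simp add: pderiv_pCons algebra_simps)
  then show ?thesis by (metis dvd_triv_left)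
qed

lemma dvd_higher_pderiv:
  fixes W :: "real poly"
  assumes "[:-c, 1:] ^ n dvd W" "m \<le> n"
  shows "[:-c, 1:] ^ (n - m) dvd (pderiv ^^ m) W"
  using assms(2)
proof (induction m)
  case (Suc m)
  then have "[:-c, 1:] ^ Suc (n - Suc m) dvd (pderiv ^^ m) W"
    by (simp add: Suc_diff_Suc del: power_Suc)
  then show ?case using dvd_pderiv_lower_power by (simp del: power_Suc)
qed (use assms in simp)

text \<open>
  Up to a constant factor, \<open>((x - a)(x - b))\<^sup>n\<close> is the polynomial \<open>(t\<^sup>2 - 1)\<^sup>n\<close> of Rodrigues' formula
  transported from \<open>[-1, 1]\<close> to \<open>[a, b]\<close>. Starting from it makes it possible to develop the
  quadrature rule on \<open>[a, b]\<close> directly, without a change of variables in integrals.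
\<close>

definition end_power :: "real \<Rightarrow> real \<Rightarrow> nat \<Rightarrow> real poly" where
  "end_power a b n = ([:-a, 1:] * [:-b, 1:]) ^ n"

lemma higher_pderiv_end_power_ends:
  assumes "m < n"
  shows "poly ((pderiv ^^ m) (end_power a b n)) a = 0"
    and "poly ((pderiv ^^ m) (end_power a b n)) b = 0"
proof -
  have *: "poly ((pderiv ^^ m) (end_power a b n)) c = 0" if "[:-c, 1:] ^ n dvd end_power a b n" for c
  proof -
    have "[:-c, 1:] ^ 1 dvd [:-c, 1:] ^ (n - m)"
      using assms by (intro le_imp_power_dvd) auto
    also have "\<dots> dvd (pderiv ^^ m) (end_power a b n)"
      using that assms by (intro dvd_higher_pderiv) auto
    finally show ?thesis by (simp add: poly_eq_0_iff_dvd)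
  qed
  show "poly ((pderiv ^^ m) (end_power a b n)) a = 0"
    by (rule *) (simp only: end_power_def power_mult_distrib dvd_triv_left)
  show "poly ((pderiv ^^ m) (end_power a b n)) b = 0"
    by (rule *) (simp only: end_power_def power_mult_distrib dvd_triv_right)
qed

text \<open>
  Integration by parts moves one derivative at a time from \<open>W\<close> to \<open>q\<close>. The boundary terms vanish,
  and \<open>q\<close> has too low a degree to survive \<open>n\<close> derivatives. For \<open>W\<close> as above this is the
  orthogonality of the Legendre polynomial to all polynomials of smaller degree.
\<close>

lemma integral_higher_pderiv_mult_eq_0:
  fixes a b :: real
  assumes "a \<le> b"
    and "\<And>m. m < n \<Longrightarrow> poly ((pderiv ^^ m) W) a = 0"
    and "\<And>m. m < n \<Longrightarrow> poly ((pderiv ^^ m) W) b = 0"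
    and "degree q < n"
  shows "integral {a<..<b} (poly ((pderiv ^^ n) W * q)) = 0"
  using assms(2-)
proof (induction n arbitrary: q)
  case (Suc n)
  let ?V = "(pderiv ^^ n) W"
  have "integral {a<..<b} (poly (?V * pderiv q)) = 0"
  proof (cases "degree q = 0")
    case True
    then have "pderiv q = 0" by (simp add: pderiv_eq_0_iff)
    then have "poly (?V * pderiv q) = (\<lambda>x. 0)" by (simp add: fun_eq_iff)
    then show ?thesis by (simp only: integral_0)
  next
    case False
    then show ?thesis using Suc by (intro Suc.IH) (auto simp: degree_pderiv)
  qed
  moreover have "integral {a<..<b} (poly (pderiv (?V * q))) = 0"
    using Suc.prems assms(1) by (subst integral_pderiv) auto
  moreover have "poly (pderiv (?V * q)) = (\<lambda>x. poly (?V * pderiv q) x + poly (pderiv ?V * q) x)"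
    by (simp add: pderiv_mult mult.commute fun_eq_iff)
  ultimately show ?case
    by (simp add: integral_add[OF poly_integrable poly_integrable] del: poly_mult)
qed auto

lemma strict_mono_on_atMost_Suc:
  fixes s :: "nat \<Rightarrow> real"
  assumes "\<And>k. k < N \<Longrightarrow> s k < s (Suc k)"
  shows "strict_mono_on {..N} s"
proof (rule strict_mono_onI)
  fix k l assume "k \<in> {..N}" "l \<in> {..N}" "k < l"
  from \<open>k < l\<close> \<open>l \<in> {..N}\<close> show "s k < s l"
  proof (induction l)
    case (Suc l)
    then show ?case using assms[of l] by (cases "k = l") auto
  qed simp
qed

text \<open>
  Rolle's theorem, applied \<open>m\<close> times: as long as \<open>m < n\<close>, the \<open>m\<close>-th derivative vanishes at both ends
  as well as at the \<open>m\<close> interior points found so far, so these \<open>m + 2\<close> zeros enclose \<open>m + 1\<close> zeros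
  of the next derivative. The enumeration \<open>t\<close> of the zeros includes the ends \<open>a\<close> and \<open>b\<close>.
\<close>

lemma higher_pderiv_end_power_roots:
  assumes "a < b" "m \<le> n"
  shows "\<exists>t. strict_mono_on {..Suc m} t \<and> t 0 = a \<and> t (Suc m) = b \<and>
            (\<forall>k\<in>{1..m}. poly ((pderiv ^^ m) (end_power a b n)) (t k) = 0)"
  using assms(2)
proof (induction m)
  case 0
  have "strict_mono_on {..Suc 0} (\<lambda>k::nat. if k = 0 then a else b)"
    using \<open>a < b\<close> by (auto simp: strict_mono_on_def)
  then show ?case by (intro exI[of _ "\<lambda>k::nat. if k = 0 then a else b"]) auto
next
  case (Suc m)
  let ?D = "\<lambda>m. poly ((pderiv ^^ m) (end_power a b n))"
  from Suc obtain t where t: "strict_mono_on {..Suc m} t" "t 0 = a" "t (Suc m) = b"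
    "\<forall>k\<in>{1..m}. ?D m (t k) = 0" by auto
  have zero: "?D m (t k) = 0" if "k \<le> Suc m" for k
  proof -
    have "k = 0 \<or> k = Suc m \<or> k \<in> {1..m}" using that by auto
    then show ?thesis
      using t higher_pderiv_end_power_ends[of m n a b] Suc.prems by auto
  qed
  have "\<exists>z. t k < z \<and> z < t (Suc k) \<and> ?D (Suc m) z = 0" if "k \<le> m" for k
  proof -
    have "t k < t (Suc k)" using t(1) that by (auto simp: strict_mono_on_def)
    then obtain z where "t k < z" "z < t (Suc k)"
        "?D m (t (Suc k)) - ?D m (t k) = (t (Suc k) - t k) * poly (pderiv ((pderiv ^^ m) (end_power a b n))) z"
      using poly_MVT by blast
    then show ?thesis using zero[of k] zero[of "Suc k"] that \<open>t k < t (Suc k)\<close> by auto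
  qed
  then obtain z where z: "\<And>k. k \<le> m \<Longrightarrow> t k < z k \<and> z k < t (Suc k) \<and> ?D (Suc m) (z k) = 0"
    by metis
  define s where "s k = (if k = 0 then a else if k = Suc (Suc m) then b else z (k - 1))" for k
  have "s k < s (Suc k)" if "k < Suc (Suc m)" for k
  proof -
    have "k = 0 \<or> k = Suc m \<or> (k \<noteq> 0 \<and> k < Suc m)" using that by auto
    moreover have "z (k - 1) < z k" if "k \<noteq> 0" "k < Suc m"
      using z[of "k - 1"] z[of k] that by fastforce
    ultimately show ?thesis
      using z[of "k - 1"] z[of k] t(2,3) by (auto simp: s_def)
  qed
  then have "strict_mono_on {..Suc (Suc m)} s"
    by (rule strict_mono_on_atMost_Suc)
  moreover have "?D (Suc m) (s k) = 0" if "k \<in> {1..Suc m}" for k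
    using that z[of "k - 1"] by (auto simp: s_def)
  moreover have "s 0 = a" "s (Suc (Suc m)) = b" by (auto simp: s_def)
  ultimately show ?case by blast
qed

text \<open>
  The Legendre polynomial of degree \<open>n\<close> on \<open>[a, b]\<close>, up to a constant factor.
\<close>

definition node_poly :: "real \<Rightarrow> real \<Rightarrow> nat \<Rightarrow> real poly" where
  "node_poly a b n = (pderiv ^^ n) (end_power a b n)"

lemma degree_node_poly: "degree (node_poly a b n) = n"
  by (simp add: node_poly_def end_power_def degree_higher_pderiv degree_power_eq degree_mult_eq)

lemma node_poly_nonzero: "node_poly a b n \<noteq> 0"
  using degree_node_poly[of a b n] by (cases n) (auto simp: node_poly_def end_power_def)

lemma node_poly_roots:
  assumes "a < b"
  shows "card {x. poly (node_poly a b n) x = 0} = n"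
    and "{x. poly (node_poly a b n) x = 0} \<subseteq> {a<..<b}"
proof -
  let ?R = "{x. poly (node_poly a b n) x = 0}"
  obtain t where t: "strict_mono_on {..Suc n} t" "t 0 = a" "t (Suc n) = b"
    "\<forall>k\<in>{1..n}. poly (node_poly a b n) (t k) = 0"
    using higher_pderiv_end_power_roots[OF assms order_refl] unfolding node_poly_def by blast
  have "inj_on t {1..n}"
    by (rule inj_on_subset[OF strict_mono_on_imp_inj_on[OF t(1)]]) auto
  then have card: "card (t ` {1..n}) = n" by (simp add: card_image)
  have sub: "t ` {1..n} \<subseteq> ?R" using t by auto
  have fin: "finite ?R" by (rule poly_roots_finite[OF node_poly_nonzero])
  have "card ?R \<le> n"
    using card_poly_roots_bound[OF node_poly_nonzero] by (simp add: degree_node_poly)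
  then have eq: "t ` {1..n} = ?R"
    using card_seteq[OF fin sub] card by simp
  show "card ?R = n" using eq card by simp
  have "a < t k \<and> t k < b" if "k \<in> {1..n}" for k
    using strict_mono_onD[OF t(1), of 0 k] strict_mono_onD[OF t(1), of k "Suc n"] t that by auto
  then have "t ` {1..n} \<subseteq> {a<..<b}" by auto
  then show "?R \<subseteq> {a<..<b}" by (simp only: eq)
qed

lemma lagrange_interpolation:
  fixes f :: "real poly"
  assumes "finite S" "degree f < card S"
  shows "f = (\<Sum>x\<in>S. smult (poly f x) (\<Prod>s\<in>S - {x}. [:- s / (x - s), 1 / (x - s):]))"
    (is "_ = ?L")
proof (rule poly_eqI_degree[of S])
  show "poly f y = poly ?L y" if "y \<in> S" for y
  proof -
    have "(\<Prod>s\<in>S - {x}. poly [:- s / (x - s), 1 / (x - s):] y) = (if x = y then 1 else 0)"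
      if "x \<in> S" for x
    proof (cases "x = y")
      case True
      then show ?thesis
        by (auto intro!: prod.neutral simp: diff_divide_distrib[symmetric])
    next
      case False
      then have "y \<in> S - {x}" using \<open>y \<in> S\<close> by auto
      then show ?thesis using False \<open>finite S\<close>
        by (auto intro!: prod_zero bexI[of _ y])
    qed
    then have "poly ?L y = (\<Sum>x\<in>S. if x = y then poly f x else 0)"
      unfolding poly_sum poly_smult poly_prod by (intro sum.cong) simp_all
    then show ?thesis
      using \<open>y \<in> S\<close> \<open>finite S\<close> by (simp add: sum.delta)
  qed
  have "degree (\<Prod>s\<in>S - {x}. [:- s / (x - s), 1 / (x - s):]) < card S" if "x \<in> S" for x
  proof -
    have "degree (\<Prod>s\<in>S - {x}. [:- s / (x - s), 1 / (x - s):])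
            \<le> (\<Sum>s\<in>S - {x}. degree [:- s / (x - s), 1 / (x - s):])"
      using degree_prod_sum_le[of "S - {x}" "\<lambda>s. [:- s / (x - s), 1 / (x - s):]"] \<open>finite S\<close>
      by (simp add: o_def)
    also have "\<dots> \<le> card (S - {x})"
      using sum_bounded_above[of "S - {x}" "\<lambda>s. degree [:- s / (x - s), 1 / (x - s):]" 1] by simp
    also have "\<dots> < card S"
      using that \<open>finite S\<close> by (intro card_Diff1_less)
    finally show ?thesis .
  qed
  then show "card S > degree ?L"
    using assms by (intro degree_sum_less) (auto intro: le_less_trans[OF degree_smult_le])
qed (use assms in auto)

lemma integral_lagrange:
  fixes f :: "real poly" and a b :: real
  assumes "finite S" "degree f < card S"
  shows "integral {a<..<b} (poly f) =
    (\<Sum>x\<in>S. integral {a<..<b} (\<lambda>y. \<Prod>s\<in>S - {x}. (y - s) / (x - s)) * poly f x)"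
proof -
  let ?l = "\<lambda>x. \<Prod>s\<in>S - {x}. [:- s / (x - s), 1 / (x - s):]"
  have l: "(\<lambda>y. \<Prod>s\<in>S - {x}. (y - s) / (x - s)) = poly (?l x)" for x
    by (auto simp: fun_eq_iff poly_prod diff_divide_distrib intro!: prod.cong)
  have "poly f = poly (\<Sum>x\<in>S. smult (poly f x) (?l x))"
    using lagrange_interpolation[OF assms] by simp
  also have "\<dots> = (\<lambda>y. \<Sum>x\<in>S. poly f x * poly (?l x) y)"
    by (simp add: poly_sum fun_eq_iff)
  finally have "integral {a<..<b} (poly f) = integral {a<..<b} (\<lambda>y. \<Sum>x\<in>S. poly f x * poly (?l x) y)"
    by simp
  also have "\<dots> = (\<Sum>x\<in>S. poly f x * integral {a<..<b} (poly (?l x)))"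
    using assms by (subst integral_sum) (auto intro!: integrable_on_mult_right poly_integrable)
  finally show ?thesis by (simp add: l mult.commute)
qed

text \<open>
  Divide \<open>f\<close> by the node polynomial. The quotient has degree below \<open>n\<close>, so by orthogonality its
  product with the node polynomial has integral zero; that product also vanishes at the nodes.
  Both sides therefore see only the remainder, which is integrated exactly because it coincides
  with its Lagrange interpolant.
\<close>

lemma gauss_exact:
  fixes a b :: real and n :: nat and f :: "real poly"
  defines "R \<equiv> {x. poly (node_poly a b n) x = 0}"
  assumes "a < b" "degree f < 2 * n"
  shows "integral {a<..<b} (poly f) =
    (\<Sum>x\<in>R. integral {a<..<b} (\<lambda>y. \<Prod>s\<in>R - {x}. (y - s) / (x - s)) * poly f x)"
proof -
  let ?P = "node_poly a b n"
  let ?q = "f div ?P" and ?r = "f mod ?P"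
  have "n > 0" using assms by auto
  have f: "f = ?P * ?q + ?r" by simp
  have r: "degree ?r < n"
    using degree_mod_less[OF node_poly_nonzero, of f a b n] \<open>n > 0\<close> by (auto simp: degree_node_poly)
  have q: "degree ?q < n"
  proof (cases "?q = 0")
    case False
    then have "degree (?P * ?q) = n + degree ?q"
      by (simp add: degree_mult_eq node_poly_nonzero degree_node_poly)
    moreover from this have "degree f = degree (?P * ?q)"
      using r by (subst f) (intro degree_add_eq_left, simp)
    ultimately show ?thesis using assms(3) by simp
  qed (use \<open>n > 0\<close> in simp)
  have "integral {a<..<b} (poly (?P * ?q)) = 0"
    unfolding node_poly_def using assms(2) q
    by (intro integral_higher_pderiv_mult_eq_0 higher_pderiv_end_power_ends)
       (auto simp: node_poly_def)
  moreover have "poly f = (\<lambda>y. poly (?P * ?q) y + poly ?r y)"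
    using f by (metis poly_add)
  ultimately have "integral {a<..<b} (poly f) = integral {a<..<b} (poly ?r)"
    by (simp add: integral_add[OF poly_integrable poly_integrable] del: poly_mult)
  also have "\<dots> = (\<Sum>x\<in>R. integral {a<..<b} (\<lambda>y. \<Prod>s\<in>R - {x}. (y - s) / (x - s)) * poly ?r x)"
    using node_poly_roots[OF assms(2), of n] r
    by (intro integral_lagrange) (auto simp: R_def intro!: poly_roots_finite node_poly_nonzero)
  also have "\<dots> = (\<Sum>x\<in>R. integral {a<..<b} (\<lambda>y. \<Prod>s\<in>R - {x}. (y - s) / (x - s)) * poly f x)"
  proof (intro sum.cong refl arg_cong2[where f = "(*)"])
    fix x assume "x \<in> R"
    then have "poly (?P * ?q) x = 0" by (simp add: R_def)
    moreover have "poly f x = poly (?P * ?q) x + poly ?r x"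
      using f by (metis poly_add)
    ultimately show "poly ?r x = poly f x" by simp
  qed
  finally show ?thesis .
qed

lemma higher_pderiv_pcompose_affine:
  "(pderiv ^^ m) (pcompose W [:c, h:]) = smult (h ^ m) (pcompose ((pderiv ^^ m) W) [:c, h:])"
  for W :: "real poly"
  by (induction m) (simp_all add: pderiv_smult pderiv_pcompose pderiv_pCons ac_simps)

lemma pcompose_power: "pcompose (W ^ n) q = pcompose W q ^ n" for W :: "'a::comm_ring_1 poly"
  by (induction n) (simp_all add: pcompose_mult pcompose_1)

text \<open>
  The affine map from \<open>[-1, 1]\<close> turns \<open>(x - a)(x - b)\<close> into \<open>h\<^sup>2 (t\<^sup>2 - 1)\<close>, where \<open>h\<close> is half the length
  of the interval, and by the chain rule it commutes with differentiation up to powers of \<open>h\<close>.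
\<close>

lemma GL_nodes_eq_roots:
  assumes "xs (i - 1) < xs i"
  shows "GL_nodes p xs i = {x. poly (node_poly (xs (i - 1)) (xs i) (Suc p)) x = 0}"
proof -
  define c h where "c = (xs (i - 1) + xs i) / 2" and "h = (xs i - xs (i - 1)) / 2"
  have h: "h > 0" using assms by (simp add: h_def)
  let ?n = "Suc p" and ?W = "end_power (xs (i - 1)) (xs i)"
  have 1: "pcompose ([:- xs (i - 1), 1:] * [:- xs i, 1:]) [:c, h:] = smult (h\<^sup>2) [:-1, 0, 1:]"
    by (simp add: pcompose_pCons c_def h_def field_simps power2_eq_square)
  then have W: "pcompose (?W ?n) [:c, h:] = smult ((h\<^sup>2) ^ ?n) ([:-1, 0, 1:] ^ ?n)"
    unfolding end_power_def by (simp only: pcompose_power smult_power[symmetric])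
  have "smult (h ^ ?n) (pcompose (node_poly (xs (i - 1)) (xs i) ?n) [:c, h:])
      = smult ((h\<^sup>2) ^ ?n) ((pderiv ^^ ?n) ([:-1, 0, 1:] ^ ?n))"
    unfolding node_poly_def
    by (simp only: higher_pderiv_pcompose_affine[symmetric] W higher_pderiv_smult)
  note poly_eq = arg_cong[OF this, of "\<lambda>q. poly q t" for t]
  have root: "h ^ ?n * poly (node_poly (xs (i - 1)) (xs i) ?n) (c + h * t)
      = (h\<^sup>2) ^ ?n * poly ((pderiv ^^ ?n) ([:-1, 0, 1:] ^ ?n)) t" for t
    using poly_eq[of t] by (simp add: poly_pcompose mult.commute del: power_Suc funpow.simps)
  then have iff: "poly (legendre_poly ?n) t = 0 \<longleftrightarrow>
      poly (node_poly (xs (i - 1)) (xs i) ?n) (c + h * t) = 0" for t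
  proof -
    have "poly (legendre_poly ?n) t = 0 \<longleftrightarrow>
        (h\<^sup>2) ^ ?n * poly ((pderiv ^^ ?n) ([:-1, 0, 1:] ^ ?n)) t = 0"
      using h unfolding legendre_poly_def poly_smult mult_eq_0_iff divide_eq_0_iff by simp
    also have "\<dots> \<longleftrightarrow> poly (node_poly (xs (i - 1)) (xs i) ?n) (c + h * t) = 0"
      using h by (simp only: root[symmetric] mult_eq_0_iff power_eq_0_iff) simp
    finally show ?thesis .
  qed
  show ?thesis
    unfolding GL_nodes_def c_def[symmetric] h_def[symmetric]
  proof (intro equalityI subsetI)
    fix x assume "x \<in> {x. poly (node_poly (xs (i - 1)) (xs i) ?n) x = 0}"
    moreover have "x = c + h * ((x - c) / h)" using h by simp
    ultimately show "x \<in> (\<lambda>t. c + h * t) ` {t. poly (legendre_poly ?n) t = 0}"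
      by (intro image_eqI[of _ _ "(x - c) / h"]) (simp_all only: mem_Collect_eq iff)
  qed (auto simp: iff)
qed

lemma GL_nodes_facts:
  assumes "xs (i - 1) < xs i"
  shows "finite (GL_nodes p xs i)" "card (GL_nodes p xs i) = Suc p" "GL_nodes p xs i \<subseteq> elem xs i"
  using node_poly_roots[OF assms, of "Suc p"] poly_roots_finite[OF node_poly_nonzero]
  unfolding GL_nodes_eq_roots[OF assms] elem_def by auto

lemma GL_quad_exact:
  assumes "xs (i - 1) < xs i" "degree f \<le> 2 * p + 1"
  shows "GL_quad p xs i (poly f) = integral (elem xs i) (poly f)"
  using gauss_exact[OF assms(1), of f "Suc p"] assms(2)
  unfolding GL_quad_def GL_weight_def elem_def GL_nodes_eq_roots[OF assms(1)] by simp

section \<open>Velocity moments of broken polynomials\<close>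

definition vel_moment ::
  "nat \<Rightarrow> (nat \<Rightarrow> real) \<Rightarrow> (real \<Rightarrow> real \<Rightarrow> real) \<Rightarrow> real poly \<Rightarrow> real \<Rightarrow> real" where
  "vel_moment Nv vs g e x = (\<Sum>j=1..Nv. integral (elem vs j) (\<lambda>v. g x v * poly e v))"

lemma poly_eq_sum_atMost: "degree q \<le> p \<Longrightarrow> poly q x = (\<Sum>a\<le>p. coeff q a * x ^ a)"
  for q :: "real poly"
  unfolding poly_altdef by (intro sum.mono_neutral_left) (auto simp: coeff_eq_0)

lemma separable_in_DG_xv:
  assumes "degree \<psi> \<le> p" "degree e \<le> p"
  shows "(\<lambda>x v. poly \<psi> x * poly e v) \<in> DG_xv p Nx Nv xs vs"
proof -
  have "poly \<psi> x * poly e v = (\<Sum>a\<le>p. \<Sum>b\<le>p. (coeff \<psi> a * coeff e b) * x ^ a * v ^ b)" for x v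
    unfolding poly_eq_sum_atMost[OF assms(1)] poly_eq_sum_atMost[OF assms(2)] sum_product
    by (intro sum.cong refl) (simp add: ac_simps)
  then show ?thesis
    unfolding DG_xv_def bipoly_on_def by (auto intro!: exI[of _ "\<lambda>a b. coeff \<psi> a * coeff e b"])
qed

text \<open>
  Grouped by powers of \<open>x\<close>, the local form shows at once that \<open>g\<close> is a polynomial in \<open>v\<close> for fixed
  \<open>x\<close> and that integrating out \<open>v\<close> leaves a polynomial of degree at most \<open>p\<close> in \<open>x\<close>.
\<close>

lemma DG_xv_local_form:
  assumes "g \<in> DG_xv p Nx Nv xs vs" "i \<in> {1..Nx}" "j \<in> {1..Nv}"
  obtains C :: "nat \<Rightarrow> real poly"
  where "\<And>x v. x \<in> elem xs i \<Longrightarrow> v \<in> elem vs j \<Longrightarrow> g x v = (\<Sum>a\<le>p. x ^ a * poly (C a) v)"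
proof -
  obtain c where c: "\<And>x v. x \<in> elem xs i \<Longrightarrow> v \<in> elem vs j \<Longrightarrow>
      g x v = (\<Sum>a\<le>p. \<Sum>b\<le>p. c a b * x ^ a * v ^ b)"
    using assms unfolding DG_xv_def bipoly_on_def by blast
  show ?thesis
  proof (rule that[of "\<lambda>a. \<Sum>b\<le>p. monom (c a b) b"])
    fix x v assume "x \<in> elem xs i" "v \<in> elem vs j"
    then show "g x v = (\<Sum>a\<le>p. x ^ a * poly (\<Sum>b\<le>p. monom (c a b) b) v)"
      by (simp add: c poly_sum poly_monom sum_distrib_left ac_simps)
  qed
qed

lemma elem_poly_integrable: "poly q integrable_on elem vs j"
  unfolding elem_def by (rule poly_integrable)

lemma DG_xv_integrable:
  assumes "g \<in> DG_xv p Nx Nv xs vs" "i \<in> {1..Nx}" "j \<in> {1..Nv}" "x \<in> elem xs i"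
  shows "(\<lambda>v. g x v * poly e v) integrable_on elem vs j"
proof -
  obtain C where C: "\<And>x v. x \<in> elem xs i \<Longrightarrow> v \<in> elem vs j \<Longrightarrow> g x v = (\<Sum>a\<le>p. x ^ a * poly (C a) v)"
    using DG_xv_local_form[OF assms(1-3)] by blast
  show ?thesis
    by (rule integrable_eq[OF elem_poly_integrable[of "(\<Sum>a\<le>p. smult (x ^ a) (C a)) * e"]])
       (simp add: C assms poly_sum)
qed

lemma elem_moment_poly:
  assumes "g \<in> DG_xv p Nx Nv xs vs" "i \<in> {1..Nx}" "j \<in> {1..Nv}"
  shows "\<exists>M. degree M \<le> p \<and>
    (\<forall>x\<in>elem xs i. integral (elem vs j) (\<lambda>v. g x v * poly e v) = poly M x)"
proof -
  obtain C where C: "\<And>x v. x \<in> elem xs i \<Longrightarrow> v \<in> elem vs j \<Longrightarrow> g x v = (\<Sum>a\<le>p. x ^ a * poly (C a) v)"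
    using DG_xv_local_form[OF assms] by blast
  define M where "M = (\<Sum>a\<le>p. monom (integral (elem vs j) (poly (C a * e))) a)"
  have "integral (elem vs j) (\<lambda>v. g x v * poly e v) = poly M x" if "x \<in> elem xs i" for x
  proof -
    have "integral (elem vs j) (\<lambda>v. g x v * poly e v)
        = integral (elem vs j) (\<lambda>v. \<Sum>a\<le>p. x ^ a * poly (C a * e) v)"
      by (intro integral_cong) (simp add: C that sum_distrib_left sum_distrib_right ac_simps)
    also have "\<dots> = (\<Sum>a\<le>p. integral (elem vs j) (\<lambda>v. x ^ a * poly (C a * e) v))"
      by (intro integral_sum integrable_on_mult_right elem_poly_integrable) auto
    also have "\<dots> = poly M x"
      unfolding integral_mult_right M_def poly_sum poly_monom by (simp only: mult.commute)
    finally show ?thesis .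
  qed
  moreover have "degree M \<le> p"
    unfolding M_def by (intro degree_sum_le) (auto intro: order.trans[OF degree_monom_le])
  ultimately show ?thesis by blast
qed

lemma vel_moment_poly:
  assumes "g \<in> DG_xv p Nx Nv xs vs" "i \<in> {1..Nx}"
  obtains M where "degree M \<le> p" "\<And>x. x \<in> elem xs i \<Longrightarrow> vel_moment Nv vs g e x = poly M x"
proof -
  have "\<forall>j\<in>{1..Nv}. \<exists>M. degree M \<le> p \<and>
    (\<forall>x\<in>elem xs i. integral (elem vs j) (\<lambda>v. g x v * poly e v) = poly M x)"
    using elem_moment_poly[OF assms] by blast
  from bchoice[OF this] obtain M where M: "\<forall>j\<in>{1..Nv}. degree (M j) \<le> p \<and>
    (\<forall>x\<in>elem xs i. integral (elem vs j) (\<lambda>v. g x v * poly e v) = poly (M j) x)" ..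
  show ?thesis
  proof (rule that[of "\<Sum>j=1..Nv. M j"])
    show "degree (\<Sum>j=1..Nv. M j) \<le> p"
      using M by (intro degree_sum_le) auto
    show "vel_moment Nv vs g e x = poly (\<Sum>j=1..Nv. M j) x" if "x \<in> elem xs i" for x
      unfolding vel_moment_def poly_sum using M that by (intro sum.cong refl) blast
  qed
qed

lemma vel_moment_add:
  assumes "g \<in> DG_xv p Nx Nv xs vs" "i \<in> {1..Nx}" "x \<in> elem xs i"
  shows "vel_moment Nv vs g (d + e) x = vel_moment Nv vs g d x + vel_moment Nv vs g e x"
  unfolding vel_moment_def sum.distrib[symmetric]
  using DG_xv_integrable[OF assms(1,2) _ assms(3)]
  by (intro sum.cong refl) (simp add: distrib_left integral_add)

lemma vel_moment_smult: "vel_moment Nv vs g (smult c e) x = c * vel_moment Nv vs g e x"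
  unfolding vel_moment_def by (simp add: sum_distrib_left mult.left_commute)

text \<open>
  Fubini's theorem. The polynomial form of \<open>g\<close> extends it continuously to the closed rectangle, and
  passing between open and closed rectangles does not change the integral.
\<close>

lemma inner_elem_separable:
  assumes "g \<in> DG_xv p Nx Nv xs vs" "i \<in> {1..Nx}" "j \<in> {1..Nv}"
  shows "inner_elem xs vs i j g (\<lambda>x v. poly \<psi> x * poly e v) =
    integral (elem xs i) (\<lambda>x. poly \<psi> x * integral (elem vs j) (\<lambda>v. g x v * poly e v))"
proof -
  obtain C where C: "\<And>x v. x \<in> elem xs i \<Longrightarrow> v \<in> elem vs j \<Longrightarrow> g x v = (\<Sum>a\<le>p. x ^ a * poly (C a) v)"
    using DG_xv_local_form[OF assms] by blast
  define g' where "g' x v = (\<Sum>a\<le>p. x ^ a * poly (C a) v)" for x v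
  let ?f = "\<lambda>(x, v). g' x v * (poly \<psi> x * poly e v)"
  let ?a = "xs (i - 1)" and ?b = "xs i" and ?c = "vs (j - 1)" and ?d = "vs j"
  have cont: "continuous_on S ?f" for S
    unfolding g'_def case_prod_beta by (intro continuous_intros)
  have "inner_elem xs vs i j g (\<lambda>x v. poly \<psi> x * poly e v) = integral (elem xs i \<times> elem vs j) ?f"
    unfolding inner_elem_def
  proof (rule integral_cong)
    fix z assume "z \<in> elem xs i \<times> elem vs j"
    then obtain x v where "z = (x, v)" "x \<in> elem xs i" "v \<in> elem vs j" by blast
    then show "(\<lambda>(x, v). g x v * (poly \<psi> x * poly e v)) z = ?f z"
      by (simp only: prod.case C g'_def)
  qed
  also have "elem xs i \<times> elem vs j = box (?a, ?c) (?b, ?d)"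
    by (auto simp: elem_def mem_box Basis_prod_def ball_Un)
  also have "integral \<dots> ?f = integral {?a..?b} (\<lambda>x. integral {?c..?d} (\<lambda>v. ?f (x, v)))"
    by (simp only: integral_open_interval integral_prod_continuous[OF cont] box_real)
  also have "\<dots> = integral (elem xs i) (\<lambda>x. integral (elem vs j) (\<lambda>v. poly \<psi> x * (g' x v * poly e v)))"
    by (simp only: integral_open_interval_real elem_def prod.case mult.left_commute)
  also have "\<dots> = integral (elem xs i) (\<lambda>x. poly \<psi> x * integral (elem vs j) (\<lambda>v. g' x v * poly e v))"
    by (simp only: integral_mult_right)
  also have "\<dots> = integral (elem xs i) (\<lambda>x. poly \<psi> x * integral (elem vs j) (\<lambda>v. g x v * poly e v))"
    by (intro integral_cong arg_cong2[where f = "(*)"] refl) (simp add: C g'_def)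
  finally show ?thesis .
qed

lemma sum_inner_elem_separable:
  assumes "g \<in> DG_xv p Nx Nv xs vs" "i \<in> {1..Nx}"
  shows "(\<Sum>j=1..Nv. inner_elem xs vs i j g (\<lambda>x v. poly \<psi> x * poly e v)) =
    integral (elem xs i) (\<lambda>x. poly \<psi> x * vel_moment Nv vs g e x)"
proof -
  have "(\<lambda>x. poly \<psi> x * integral (elem vs j) (\<lambda>v. g x v * poly e v)) integrable_on elem xs i"
    if j: "j \<in> {1..Nv}" for j
  proof -
    obtain M where "\<forall>x\<in>elem xs i. integral (elem vs j) (\<lambda>v. g x v * poly e v) = poly M x"
      using elem_moment_poly[OF assms j] by blast
    then show ?thesis
      by (intro integrable_eq[OF elem_poly_integrable[of "\<psi> * M"]]) simp
  qed
  then have "(\<Sum>j=1..Nv. integral (elem xs i) (\<lambda>x. poly \<psi> x * integral (elem vs j) (\<lambda>v. g x v * poly e v)))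
      = integral (elem xs i) (\<lambda>x. poly \<psi> x * vel_moment Nv vs g e x)"
    unfolding vel_moment_def sum_distrib_left by (intro integral_sum[symmetric]) auto
  then show ?thesis by (simp add: inner_elem_separable[OF assms])
qed

section \<open>Conservation by the Lenard-Bernstein form\<close>

lemma left_lim_poly: "left_lim (\<lambda>v. c * poly q v) a = c * poly q a"
  unfolding left_lim_def by (intro tendsto_Lim tendsto_intros) auto

lemma right_lim_poly: "right_lim (\<lambda>v. c * poly q v) a = c * poly q a"
  unfolding right_lim_def by (intro tendsto_Lim tendsto_intros) auto

lemma deriv_poly: "deriv (\<lambda>v. c * poly q v) = (\<lambda>v. c * poly (pderiv q) v)"
  by (intro ext DERIV_imp_deriv DERIV_cmult poly_DERIV)

text \<open>
  Everything the form collects at one velocity interface, from drift and diffusion together, when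
  it is tested with \<open>e\<close>. It takes the same value seen from either of the two adjacent elements, since
  \<open>e\<close> is smooth. The drift flux and the derivative are grouped as in the boundary condition.
\<close>

definition interface_flux ::
  "(nat \<Rightarrow> real) \<Rightarrow> (real \<Rightarrow> real ^ 3) \<Rightarrow> (nat \<Rightarrow> real \<Rightarrow> real) \<Rightarrow>
   (nat \<Rightarrow> real \<Rightarrow> real \<Rightarrow> real) \<Rightarrow> real poly \<Rightarrow> real \<Rightarrow> nat \<Rightarrow> real" where
  "interface_flux vs rho F G e x k =
     (F k x - temp rho x * deriv (G k x) (vs k)) * poly e (vs k)
     + temp rho x * G k x (vs k) * poly (pderiv e) (vs k)"

lemma LB_form_separable:
  "LB_form (GL_quad p xs) vs g rho F G (\<lambda>x v. poly \<psi> x * poly e v) i j =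
   GL_quad p xs i (\<lambda>x. poly \<psi> x *
     (interface_flux vs rho F (G i) e x j - interface_flux vs rho F (G i) e x (j - 1)
      - integral (elem vs j) (\<lambda>v. g x v * poly ([:bulk_u rho x, -1:] * pderiv e) v)
      - temp rho x * integral (elem vs j) (\<lambda>v. g x v * poly (pderiv (pderiv e)) v)))"
proof -
  have drift: "integral (elem vs j) (\<lambda>v. drift rho x v * g x v * (poly \<psi> x * poly (pderiv e) v)) =
      poly \<psi> x * integral (elem vs j) (\<lambda>v. g x v * poly ([:bulk_u rho x, -1:] * pderiv e) v)" for x
    unfolding integral_mult_right[symmetric]
    by (intro integral_cong) (simp add: drift_def algebra_simps)
  have diffusion: "integral (elem vs j) (\<lambda>v. temp rho x * g x v * (poly \<psi> x * poly (pderiv (pderiv e)) v)) =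
      poly \<psi> x * (temp rho x * integral (elem vs j) (\<lambda>v. g x v * poly (pderiv (pderiv e)) v))" for x
    unfolding integral_mult_right[symmetric]
    by (intro integral_cong) (simp add: ac_simps)
  show ?thesis
    unfolding LB_form_def left_lim_poly right_lim_poly deriv_poly drift diffusion
    unfolding GL_quad_def sum_subtractf[symmetric] interface_flux_def
    by (intro sum.cong refl) (simp add: algebra_simps)
qed

lemma sum_telescope_from_1:
  fixes f :: "nat \<Rightarrow> real"
  shows "(\<Sum>j=1..N. f j - f (j - 1)) = f N - f 0"
  by (induction N) auto

text \<open>
  The interface fluxes telescope over the velocity elements, and the fluxes at both ends are zero by
  the boundary conditions. These hold for points of the open element only, so it matters that the
  Gauss-Legendre nodes are interior.
\<close>

lemma sum_LB_form_separable:
  assumes "LB_interface_data p Nx Nv xs vs g rho F G" "i \<in> {1..Nx}" "xs (i - 1) < xs i"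
  shows "(\<Sum>j=1..Nv. LB_form (GL_quad p xs) vs g rho F G (\<lambda>x v. poly \<psi> x * poly e v) i j) =
    - GL_quad p xs i (\<lambda>x. poly \<psi> x *
        (vel_moment Nv vs g ([:bulk_u rho x, -1:] * pderiv e) x
         + temp rho x * vel_moment Nv vs g (pderiv (pderiv e)) x))"
proof -
  have boundary: "interface_flux vs rho F (G i) e x k = 0" if "x \<in> GL_nodes p xs i" "k \<in> {0, Nv}" for x k
    using that assms GL_nodes_facts(3)[of xs i p]
    unfolding LB_interface_data_def interface_flux_def by (auto simp: subset_iff)
  let ?T = "\<lambda>x. interface_flux vs rho F (G i) e x"
  let ?A = "\<lambda>x j. integral (elem vs j) (\<lambda>v. g x v * poly ([:bulk_u rho x, -1:] * pderiv e) v)"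
  let ?B = "\<lambda>x j. integral (elem vs j) (\<lambda>v. g x v * poly (pderiv (pderiv e)) v)"
  have sum_j: "(\<Sum>j=1..Nv. ?T x j - ?T x (j - 1) - ?A x j - temp rho x * ?B x j) =
      - ((\<Sum>j=1..Nv. ?A x j) + temp rho x * (\<Sum>j=1..Nv. ?B x j))"
    if "x \<in> GL_nodes p xs i" for x
    using boundary[OF that] sum_telescope_from_1[of "?T x" Nv]
    by (simp add: sum_subtractf sum_distrib_left del: One_nat_def)
  have "(\<Sum>j=1..Nv. LB_form (GL_quad p xs) vs g rho F G (\<lambda>x v. poly \<psi> x * poly e v) i j) =
    GL_quad p xs i (\<lambda>x. poly \<psi> x * (\<Sum>j=1..Nv. ?T x j - ?T x (j - 1) - ?A x j - temp rho x * ?B x j))"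
    unfolding LB_form_separable GL_quad_def sum_distrib_left by (rule sum.swap)
  also have "\<dots> = - GL_quad p xs i (\<lambda>x. poly \<psi> x *
      ((\<Sum>j=1..Nv. ?A x j) + temp rho x * (\<Sum>j=1..Nv. ?B x j)))"
    unfolding GL_quad_def sum_negf[symmetric] by (intro sum.cong refl) (simp only: sum_j mult_minus_right)
  finally show ?thesis unfolding vel_moment_def .
qed

text \<open>
  The uniqueness argument: zero data at \<open>p + 1\<close> nodes force the old moment to vanish on the whole
  element, and testing with the new moment itself shows that its square has integral zero, since
  exact quadrature gives the damping term a sign.
\<close>

lemma vanishing_moment:
  assumes "xs (i - 1) < xs i" "i \<in> {1..Nx}" "0 \<le> c"
    and g_star: "g_star \<in> DG_xv p Nx Nv xs vs"
    and g_new: "g_new \<in> DG_xv p Nx Nv xs vs"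
    and star0: "\<And>x. x \<in> GL_nodes p xs i \<Longrightarrow> vel_moment Nv vs g_star e x = 0"
    and weak: "\<And>\<psi>. degree \<psi> \<le> p \<Longrightarrow>
      integral (elem xs i) (\<lambda>x. poly \<psi> x * vel_moment Nv vs g_new e x) =
      integral (elem xs i) (\<lambda>x. poly \<psi> x * vel_moment Nv vs g_star e x)
      - c * GL_quad p xs i (\<lambda>x. poly \<psi> x * vel_moment Nv vs g_new e x)"
    and "x \<in> GL_nodes p xs i"
  shows "vel_moment Nv vs g_new e x = 0"
proof -
  note nodes = GL_nodes_facts[OF assms(1), of p]
  obtain S where S: "degree S \<le> p" "\<And>x. x \<in> elem xs i \<Longrightarrow> vel_moment Nv vs g_star e x = poly S x"
    using vel_moment_poly[OF g_star assms(2), where e = e] by blast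
  obtain M where M: "degree M \<le> p" "\<And>x. x \<in> elem xs i \<Longrightarrow> vel_moment Nv vs g_new e x = poly M x"
    using vel_moment_poly[OF g_new assms(2), where e = e] by blast
  have "poly S x = 0" if "x \<in> GL_nodes p xs i" for x
    using S(2)[of x] star0[OF that] nodes(3) that by auto
  then have S0: "S = 0"
    using S(1) nodes(2) by (intro poly_eqI_degree[of "GL_nodes p xs i"]) auto
  let ?I = "integral (elem xs i) (poly (M * M))"
  have "integral (elem xs i) (\<lambda>x. poly M x * vel_moment Nv vs g_new e x) = ?I"
    by (intro integral_cong) (simp add: M)
  moreover have "integral (elem xs i) (\<lambda>x. poly M x * vel_moment Nv vs g_star e x) = integral (elem xs i) (\<lambda>x. 0)"
    by (intro integral_cong) (simp add: S(2) S0)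
  \<comment> \<open>\<open>M * M\<close> has degree at most \<open>2 p\<close>, so the rule integrates it exactly.\<close>
  moreover have "GL_quad p xs i (\<lambda>x. poly M x * vel_moment Nv vs g_new e x) = ?I"
  proof -
    have "degree (M * M) \<le> 2 * p + 1" using degree_mult_le[of M M] M(1) by simp
    note GL_quad_exact[OF assms(1) this, symmetric]
    also have "GL_quad p xs i (poly (M * M)) = GL_quad p xs i (\<lambda>x. poly M x * vel_moment Nv vs g_new e x)"
      unfolding GL_quad_def using nodes(3) M(2) by (intro sum.cong) (auto simp: subset_iff)
    finally show ?thesis by simp
  qed
  ultimately have "?I = 0 - c * ?I"
    using weak[OF M(1)] by (simp only: integral_0)
  then have "(1 + c) * ?I = 0" by (simp add: distrib_right del: poly_mult)
  then have "?I = 0" using \<open>0 \<le> c\<close> unfolding mult_eq_0_iff by linarith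
  then have I0: "integral {xs (i - 1)..xs i} (poly (M * M)) = 0"
    by (simp only: integral_open_interval_real elem_def)
  have "\<forall>x\<in>{xs (i - 1)..xs i}. poly (M * M) x = 0"
  proof (rule integral_eq_0_iff[OF _ assms(1), THEN iffD1, OF _ _ I0])
    show "continuous_on {xs (i - 1)..xs i} (poly (M * M))"
      by (intro continuous_intros)
  qed simp
  moreover have x: "x \<in> elem xs i" using assms(8) nodes(3) by blast
  then have "x \<in> {xs (i - 1)..xs i}" by (simp add: elem_def)
  ultimately have "poly (M * M) x = 0" by (rule bspec)
  then show ?thesis by (simp add: M(2)[OF x])
qed

section \<open>Preservation of zero moments\<close>

lemma evec_nth: "evec v $ 1 = 1" "evec v $ 2 = v" "evec v $ 3 = v\<^sup>2 / 2"
  by (simp_all add: evec_def)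

lemma moments_component:
  assumes "g \<in> DG_xv p Nx Nv xs vs" "i \<in> {1..Nx}" "x \<in> elem xs i"
  shows "moments Nv vs g x $ 1 = vel_moment Nv vs g [:1:] x"
    and "moments Nv vs g x $ 2 = vel_moment Nv vs g [:0, 1:] x"
    and "moments Nv vs g x $ 3 = vel_moment Nv vs g [:0, 0, 1 / 2:] x"
proof -
  define E :: "3 \<Rightarrow> real poly"
    where "E m = (if m = 1 then [:1:] else if m = 2 then [:0, 1:] else [:0, 0, 1 / 2:])" for m
  have E: "(g x v *\<^sub>R evec v) $ m = g x v * poly (E m) v" for m v
  proof -
    have "m = 1 \<or> m = 2 \<or> m = 3" by (rule exhaust_3)
    then show ?thesis
      by (elim disjE) (simp_all add: E_def evec_nth power2_eq_square)
  qed
  have "moments Nv vs g x $ m = vel_moment Nv vs g (E m) x" for m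
  proof -
    have "integral (elem vs j) (\<lambda>v. g x v *\<^sub>R evec v) $ m = integral (elem vs j) (\<lambda>v. g x v * poly (E m) v)"
      if j: "j \<in> {1..Nv}" for j
    proof -
      have "(\<lambda>v. g x v *\<^sub>R evec v) integrable_on elem vs j"
      proof (subst integrable_componentwise_iff, safe)
        fix b :: "real ^ 3" assume "b \<in> Basis"
        then obtain k where "b = axis k 1" by (auto simp: Basis_vec_def)
        then show "(\<lambda>v. (g x v *\<^sub>R evec v) \<bullet> b) integrable_on elem vs j"
          using DG_xv_integrable[OF assms(1,2) j assms(3)] by (simp add: inner_axis E del: vector_scaleR_component)
      qed
      from integral_component_eq_cart[OF this, of m] show ?thesis by (simp add: E del: vector_scaleR_component)
    qed
    then show ?thesis by (simp add: moments_def vel_moment_def)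
  qed
  from this[of 1] this[of 2] this[of 3] show
    "moments Nv vs g x $ 1 = vel_moment Nv vs g [:1:] x"
    "moments Nv vs g x $ 2 = vel_moment Nv vs g [:0, 1:] x"
    "moments Nv vs g x $ 3 = vel_moment Nv vs g [:0, 0, 1 / 2:] x"
    by (simp_all add: E_def)
qed

theorem proposition7:
  fixes p Nx Nv :: nat
    and xmin xmax vmin vmax \<nu> dt :: real
    and xs vs :: "nat \<Rightarrow> real"
    and rho_f :: "real \<Rightarrow> real ^ 3"
    and g_star g_new :: "real \<Rightarrow> real \<Rightarrow> real"
    and F :: "nat \<Rightarrow> real \<Rightarrow> real"
    and G :: "nat \<Rightarrow> nat \<Rightarrow> real \<Rightarrow> real \<Rightarrow> real"
  assumes "p \<ge> 2" and "\<nu> > 0" and "dt > 0"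
    and "mesh Nx xmin xmax xs" and "mesh Nv vmin vmax vs"
    and "\<forall>m. (\<lambda>x. rho_f x $ m) \<in> DG_x p Nx xs"
    and "\<forall>i\<in>{1..Nx}. \<forall>x\<in>GL_nodes p xs i. rho_f x $ 1 \<noteq> 0"
    and "g_star \<in> DG_xv p Nx Nv xs vs"
    and "g_new \<in> DG_xv p Nx Nv xs vs"
    and "LB_interface_data p Nx Nv xs vs g_new rho_f F G"
    and "\<forall>\<phi>\<in>DG_xv p Nx Nv xs vs. \<forall>i\<in>{1..Nx}. \<forall>j\<in>{1..Nv}.
           inner_elem xs vs i j g_new \<phi> =
           inner_elem xs vs i j g_star \<phi>
           - dt * \<nu> * LB_form (GL_quad p xs) vs g_new rho_f F G \<phi> i j"
    and "\<forall>i\<in>{1..Nx}. \<forall>x\<in>GL_nodes p xs i. moments Nv vs g_star x = 0"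
  shows "\<forall>i\<in>{1..Nx}. \<forall>x\<in>GL_nodes p xs i. moments Nv vs g_new x = 0"
proof (rule ballI)
  fix i assume i: "i \<in> {1..Nx}"
  have less: "xs (i - 1) < xs i"
    using \<open>mesh Nx xmin xmax xs\<close> i unfolding mesh_def by (cases i) auto
  let ?V = "vel_moment Nv vs g_new" and ?Q = "GL_quad p xs i" and ?N = "GL_nodes p xs i"
  have node_elem: "x \<in> elem xs i" if "x \<in> ?N" for x
    using GL_nodes_facts(3)[OF less] that by blast
  have balance: "integral (elem xs i) (\<lambda>x. poly \<psi> x * ?V e x) =
      integral (elem xs i) (\<lambda>x. poly \<psi> x * vel_moment Nv vs g_star e x)
      + dt * \<nu> * ?Q (\<lambda>x. poly \<psi> x * (?V ([:bulk_u rho_f x, -1:] * pderiv e) x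
                                       + temp rho_f x * ?V (pderiv (pderiv e)) x))"
    if "degree \<psi> \<le> p" "degree e \<le> 2" for \<psi> e
  proof -
    have "(\<lambda>x v. poly \<psi> x * poly e v) \<in> DG_xv p Nx Nv xs vs"
      using that \<open>p \<ge> 2\<close> by (intro separable_in_DG_xv) auto
    then have "inner_elem xs vs i j g_new (\<lambda>x v. poly \<psi> x * poly e v) =
           inner_elem xs vs i j g_star (\<lambda>x v. poly \<psi> x * poly e v)
           - dt * \<nu> * LB_form (GL_quad p xs) vs g_new rho_f F G (\<lambda>x v. poly \<psi> x * poly e v) i j"
      if "j \<in> {1..Nv}" for j
      using assms(11) i that by blast
    then have "(\<Sum>j=1..Nv. inner_elem xs vs i j g_new (\<lambda>x v. poly \<psi> x * poly e v)) =
           (\<Sum>j=1..Nv. inner_elem xs vs i j g_star (\<lambda>x v. poly \<psi> x * poly e v))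
           - dt * \<nu> * (\<Sum>j=1..Nv. LB_form (GL_quad p xs) vs g_new rho_f F G (\<lambda>x v. poly \<psi> x * poly e v) i j)"
      by (simp add: sum_subtractf sum_distrib_left)
    then show ?thesis
      unfolding sum_inner_elem_separable[OF assms(9) i] sum_inner_elem_separable[OF assms(8) i]
        sum_LB_form_separable[OF assms(10) i less] by simp
  qed
  \<comment> \<open>The bracket in \<open>balance\<close> equals \<open>- \<kappa>\<close> times the moment itself, with \<open>\<kappa> = 0, 1, 2\<close>
     for mass, momentum and energy; each case uses the previous ones.\<close>
  have vanish: "?V e x = 0"
    if e: "degree e \<le> 2" and "0 \<le> \<kappa>"
      and star: "\<And>x. x \<in> ?N \<Longrightarrow> vel_moment Nv vs g_star e x = 0"
      and closure: "\<And>x. x \<in> ?N \<Longrightarrow> ?V ([:bulk_u rho_f x, -1:] * pderiv e) x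
                  + temp rho_f x * ?V (pderiv (pderiv e)) x = - \<kappa> * ?V e x"
      and "x \<in> ?N" for e x \<kappa>
  proof (rule vanishing_moment[OF less i _ assms(8,9) star _ \<open>x \<in> ?N\<close>])
    show "0 \<le> dt * \<nu> * \<kappa>" using assms(2,3) \<open>0 \<le> \<kappa>\<close> by simp
    fix \<psi> :: "real poly" assume "degree \<psi> \<le> p"
    have "?Q (\<lambda>x. poly \<psi> x * (?V ([:bulk_u rho_f x, -1:] * pderiv e) x
              + temp rho_f x * ?V (pderiv (pderiv e)) x)) = - \<kappa> * ?Q (\<lambda>x. poly \<psi> x * ?V e x)"
      unfolding GL_quad_def sum_distrib_left 
      by (intro sum.cong refl) (simp only: closure, simp)
    then show "integral (elem xs i) (\<lambda>x. poly \<psi> x * ?V e x) =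
      integral (elem xs i) (\<lambda>x. poly \<psi> x * vel_moment Nv vs g_star e x)
      - dt * \<nu> * \<kappa> * ?Q (\<lambda>x. poly \<psi> x * ?V e x)"
      using balance[OF \<open>degree \<psi> \<le> p\<close> e] by simp
  qed
  have star: "vel_moment Nv vs g_star [:1:] x = 0" "vel_moment Nv vs g_star [:0, 1:] x = 0"
    "vel_moment Nv vs g_star [:0, 0, 1 / 2:] x = 0" if "x \<in> ?N" for x
    using moments_component[OF assms(8) i node_elem[OF that]] assms(12) i that by auto
  have V0: "?V 0 x = 0" for x by (simp add: vel_moment_def)
  have V_lin: "?V (smult a d + smult b e) x = a * ?V d x + b * ?V e x" if "x \<in> ?N" for a b d e x
    by (simp only: vel_moment_add[OF assms(9) i node_elem[OF that]] vel_moment_smult)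
  have mass: "?V [:1:] x = 0" if x: "x \<in> ?N" for x
  proof (rule vanish[of _ 0, OF _ _ star(1) _ x])
    fix x
    have "[:bulk_u rho_f x, -1:] * pderiv [:1:] = 0" "pderiv (pderiv [:1::real:]) = 0"
      by (simp_all add: pderiv_pCons)
    then show "?V ([:bulk_u rho_f x, -1:] * pderiv [:1:]) x
        + temp rho_f x * ?V (pderiv (pderiv [:1:])) x = - 0 * ?V [:1:] x"
      by (simp only: V0)
  qed simp_all
  have momentum: "?V [:0, 1:] x = 0" if x: "x \<in> ?N" for x
  proof (rule vanish[of _ 1, OF _ _ star(2) _ x])
    fix x assume x: "x \<in> ?N"
    have "[:bulk_u rho_f x, -1:] * pderiv [:0, 1:]
          = smult (bulk_u rho_f x) [:1:] + smult (-1) [:0, 1:]"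
      and "pderiv (pderiv [:0, 1::real:]) = 0"
      by (simp_all add: pderiv_pCons)
    then show "?V ([:bulk_u rho_f x, -1:] * pderiv [:0, 1:]) x
        + temp rho_f x * ?V (pderiv (pderiv [:0, 1:])) x = - 1 * ?V [:0, 1:] x"
      by (simp only: V0 V_lin[OF x] mass[OF x])
  qed simp_all
  have energy: "?V [:0, 0, 1 / 2:] x = 0" if x: "x \<in> ?N" for x
  proof (rule vanish[of _ 2, OF _ _ star(3) _ x])
    fix x assume x: "x \<in> ?N"
    have "[:bulk_u rho_f x, -1:] * pderiv [:0, 0, 1 / 2:]
          = smult (bulk_u rho_f x) [:0, 1:] + smult (-2) [:0, 0, 1 / 2:]"
      and "pderiv (pderiv [:0, 0, 1 / 2::real:]) = [:1:]"
      by (simp_all add: pderiv_pCons)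
    then show "?V ([:bulk_u rho_f x, -1:] * pderiv [:0, 0, 1 / 2:]) x
        + temp rho_f x * ?V (pderiv (pderiv [:0, 0, 1 / 2:])) x = - 2 * ?V [:0, 0, 1 / 2:] x"
      by (simp only: V_lin[OF x] mass[OF x] momentum[OF x])
  qed simp_all
  show "\<forall>x\<in>?N. moments Nv vs g_new x = 0"
  proof
    fix x assume x: "x \<in> ?N"
    show "moments Nv vs g_new x = 0"
      by (simp only: vec_eq_iff forall_3 zero_index mass[OF x] momentum[OF x] energy[OF x]
          moments_component[OF assms(9) i node_elem[OF x]])
  qed
qed

end
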